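(* Let $m\geq 4$ and let $g\in L^\infty_m(\mathbb{S}^1)$ be a solution of the steady problem \[ G\,\partial_\theta g=0,\qquad 4G+\partial_{\theta\theta}G=g . \] Then either $g$ is constant, or $g$ is piecewise constant with a finite number of jumps, and these jumps occur at the global maxima and minima of $\partial_\theta G$, which have exactly opposite non-zero values.
   Context: $\mathbb{S}^1=\mathbb{R}/2\pi\mathbb{Z}$. $L^\infty_m(\mathbb{S}^1)$ denotes bounded measurable $m$-fold symmetric functions, i.e. $g(\theta+2\pi/m)=g(\theta)$. For $m\ge 3$ the operator $4+\partial_{\theta\theta}$ is invertible on $m$-fold symmetric functions, so $G=(4+\partial_{\theta\theta})^{-1}g\in W^{2,\infty}$ is determined by $g$; the equation $G\partial_\theta g=0$ is understood in the sense of distributions, e.g. as $\partial_\theta(Gg)-(\partial_\theta G)g=0$. *)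

theory Defs
  imports "HOL-Analysis.Analysis"
begin

text \<open>Smooth 2pi-periodic test functions, i.e. test functions on the circle S^1 = R/2piZ.\<close>
definition smooth_periodic :: "(real \<Rightarrow> real) \<Rightarrow> bool" where
  "smooth_periodic \<phi> \<longleftrightarrow>
     (\<forall>n x. (deriv ^^ n) \<phi> differentiable (at x)) \<and> (\<forall>x. \<phi> (x + 2 * pi) = \<phi> x)"

definition ae_const_on :: "(real \<Rightarrow> real) \<Rightarrow> real \<Rightarrow> real \<Rightarrow> bool" where
  "ae_const_on g a b \<longleftrightarrow> (\<exists>c. AE x in lborel. x \<in> {a<..<b} \<longrightarrow> g x = c)"

end

theory Submission
  imports Defs "HOL-Library.Real_Mod"
begin

text \<open>
  The energy \<open>Q = G'\<^sup>2 + 4 G\<^sup>2\<close> has derivative \<open>2 G' g\<close>, so the weak equation says that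
  \<open>2 G g - Q\<close> has vanishing weak derivative, that is, \<open>2 G g = Q - E\<close> almost everywhere for a
  constant \<open>E\<close>. Where \<open>G\<close> is nonzero, \<open>(Q - E) / (2 G)\<close> has derivative zero, so \<open>g\<close> is locally
  constant; at a zero of \<open>G\<close>, \<open>Q = E\<close> and hence \<open>G'\<^sup>2 = E\<close>.

  If \<open>g\<close> jumps, then \<open>G\<close> has a zero, and symmetry bounds the length of each component \<open>(a, b)\<close> of
  its nonzero set by \<open>2 \<pi> / m \<le> \<pi> / 2\<close>. Testing \<open>G'' + 4 G = c\<close> on \<open>(a, b)\<close> against
  \<open>sin (2 (x - a))\<close>, which is nonnegative there, gives \<open>c G \<le> 0\<close>, so \<open>Q \<le> E\<close> everywhere. Hence
  \<open>\<bar>G'\<bar> \<le> \<surd>E\<close>, with both signs attained at the two ends of a component, and \<open>E > 0\<close> makes the zeros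
  of \<open>G\<close> simple and thus finite in number modulo \<open>2 \<pi>\<close>.
\<close>

section \<open>Almost everywhere statements\<close>

lemma AE_lborel_iff_negligible:
  fixes P :: "'a::euclidean_space \<Rightarrow> bool"
  shows "(AE x in lborel. P x) \<longleftrightarrow> negligible {x. \<not> P x}"
proof -
  have "(AE x in lborel. P x) \<longleftrightarrow> (AE x in lebesgue. P x)"
    by (rule AE_completion_iff[symmetric])
  also have "\<dots> \<longleftrightarrow> negligible {x. \<not> P x}"
    by (simp add: AE_iff_null_sets[symmetric] eventually_ae_filter negligible_iff_null_sets)
       (metis (no_types, lifting) mem_Collect_eq negligible_iff_null_sets negligible_subset subsetI)
  finally show ?thesis .
qed

lemma AE_lborel_translate_iff:
  fixes P :: "'a::euclidean_space \<Rightarrow> bool"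
  shows "(AE x in lborel. P (c + x)) \<longleftrightarrow> (AE x in lborel. P x)"
proof -
  have "(+) c ` {x. \<not> P (c + x)} = {x. \<not> P x}"
    using surj_plus[of c] by (fastforce simp: image_iff)
  then have "negligible {x. \<not> P (c + x)} \<longleftrightarrow> negligible {x. \<not> P x}"
    by (metis negligible_translation negligible_translation_rev)
  then show ?thesis
    by (simp add: AE_lborel_iff_negligible)
qed

lemma continuous_le_of_AE_le:
  fixes u v :: "'a::euclidean_space \<Rightarrow> real"
  assumes "continuous_on UNIV u" "continuous_on UNIV v" "AE x in lborel. u x \<le> v x"
  shows "u x \<le> v x"
proof -
  have "open {x. v x < u x}"
    by (intro open_Collect_less assms)
  moreover have "negligible {x. v x < u x}"
    using assms(3) by (simp add: AE_lborel_iff_negligible not_le)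
  ultimately have "{x. v x < u x} = {}"
    using open_not_negligible by blast
  then show ?thesis
    by (simp add: set_eq_iff not_less)
qed

lemma AE_of_locally_AE:
  fixes P :: "'a::euclidean_space \<Rightarrow> bool"
  assumes "\<And>x. x \<in> S \<Longrightarrow> \<exists>U. open U \<and> x \<in> U \<and> (AE y in lborel. y \<in> U \<longrightarrow> P y)"
  shows "AE y in lborel. y \<in> S \<longrightarrow> P y"
proof -
  define N where "N = {y \<in> S. \<not> P y}"
  have "\<exists>V. openin (top_of_set N) V \<and> x \<in> V \<and> negligible V" if x: "x \<in> N" for x
  proof -
    obtain U where "open U" "x \<in> U" and U: "AE y in lborel. y \<in> U \<longrightarrow> P y"
      using assms[of x] x by (auto simp: N_def)
    moreover have "negligible (N \<inter> U)"
      using U unfolding AE_lborel_iff_negligible N_def by (rule negligible_subset) auto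
    ultimately show ?thesis
      using x by (intro exI[of _ "N \<inter> U"]) auto
  qed
  then have "negligible N"
    using locally_negligible_alt by blast
  then show ?thesis
    by (simp add: AE_lborel_iff_negligible N_def)
qed

lemma AE_const_unique_on_open:
  fixes f :: "'a::euclidean_space \<Rightarrow> 'b"
  assumes "open U" "U \<noteq> {}"
    and "AE y in lborel. y \<in> U \<longrightarrow> f y = c" "AE y in lborel. y \<in> U \<longrightarrow> f y = d"
  shows "c = d"
proof (rule ccontr)
  assume "c \<noteq> d"
  have "AE y in lborel. y \<notin> U"
    using assms(3,4) by eventually_elim (use \<open>c \<noteq> d\<close> in auto)
  then show False
    using open_not_negligible[OF assms(1,2)] by (simp add: AE_lborel_iff_negligible)
qed

lemma AE_const_of_locally_AE_const:
  fixes f :: "'a::euclidean_space \<Rightarrow> 'b"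
  assumes "connected S"
    and loc: "\<And>x. x \<in> S \<Longrightarrow> \<exists>U c. open U \<and> x \<in> U \<and> (AE y in lborel. y \<in> U \<longrightarrow> f y = c)"
  shows "\<exists>c. AE y in lborel. y \<in> S \<longrightarrow> f y = c"
proof (cases "S = {}")
  case False
  then obtain x0 where "x0 \<in> S"
    by blast
  obtain U v where U: "\<And>x. x \<in> S \<Longrightarrow> open (U x)" "\<And>x. x \<in> S \<Longrightarrow> x \<in> U x"
      "\<And>x. x \<in> S \<Longrightarrow> AE y in lborel. y \<in> U x \<longrightarrow> f y = v x"
    using loc by metis
  have v_eq: "v x = v z" if "x \<in> S" "z \<in> S" "z \<in> U x" for x z
  proof (rule AE_const_unique_on_open[of "U x \<inter> U z"])
    show "AE y in lborel. y \<in> U x \<inter> U z \<longrightarrow> f y = v x"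
      using U(3)[OF that(1)] by eventually_elim simp
    show "AE y in lborel. y \<in> U x \<inter> U z \<longrightarrow> f y = v z"
      using U(3)[OF that(2)] by eventually_elim simp
  qed (use U that in auto)
  have v_const: "v x0 = v z" if "z \<in> S" for z
  proof (rule connected_local_const[OF assms(1) \<open>x0 \<in> S\<close> that], rule ballI)
    fix a assume "a \<in> S"
    then have "\<forall>\<^sub>F b in at a within S. b \<in> S \<and> b \<in> U a"
      using U(1,2) by (auto simp: eventually_at_topological)
    then show "\<forall>\<^sub>F b in at a within S. v a = v b"
      by eventually_elim (use v_eq \<open>a \<in> S\<close> in blast)
  qed
  have "AE y in lborel. y \<in> S \<longrightarrow> f y = v x0"
  proof (rule AE_of_locally_AE)
    show "\<exists>W. open W \<and> x \<in> W \<and> (AE y in lborel. y \<in> W \<longrightarrow> f y = v x0)" if "x \<in> S" for x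
      using U[OF that] v_const[OF that] by auto
  qed
  then show ?thesis
    by blast
qed simp

section \<open>Periodic functions\<close>

lemma periodic_rmod:
  fixes f :: "real \<Rightarrow> 'a"
  assumes "p > 0" and periodic: "\<And>x. f (x + p) = f x"
  shows "f (x rmod p) = f x"
proof -
  interpret periodic_fun_simple f p
    by unfold_locales (rule periodic)
  show ?thesis
    using minus_of_int[of x "\<lfloor>x / p\<rfloor>"] assms(1) by (simp add: rmod_def mult.commute)
qed

lemma periodic_of_period_fraction:
  fixes f :: "real \<Rightarrow> 'a"
  assumes "n > 0" and periodic: "\<And>x. f (x + p / real n) = f x"
  shows "f (x + p) = f x"
proof -
  interpret periodic_fun_simple f "p / real n"
    by unfold_locales (rule periodic)
  show ?thesis
    using plus_of_nat[of x n] assms(1) by simp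
qed

lemma deriv_periodic:
  assumes "\<And>x. f (x + p) = f x"
  shows "deriv f (x + p) = deriv f x"
  using assms by (simp add: deriv_def DERIV_shift)

section \<open>Bounded Borel functions\<close>

definition bounded_borel :: "('a::topological_space \<Rightarrow> real) \<Rightarrow> bool" where
  "bounded_borel f \<longleftrightarrow> f \<in> borel_measurable borel \<and> bounded (range f)"

lemma bounded_borel_measurable: "bounded_borel f \<Longrightarrow> f \<in> borel_measurable borel"
  by (simp add: bounded_borel_def)

lemma bounded_borel_bound:
  assumes "bounded_borel f"
  obtains B where "B > 0" "\<And>x. \<bar>f x\<bar> \<le> B"
  using assms by (auto simp: bounded_borel_def bounded_pos)

lemma bounded_borel_const: "bounded_borel (\<lambda>x. c)"
  by (simp add: bounded_borel_def image_constant_conv)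

lemma bounded_borel_add: "bounded_borel f \<Longrightarrow> bounded_borel g \<Longrightarrow> bounded_borel (\<lambda>x. f x + g x)"
  unfolding bounded_borel_def by (intro conjI borel_measurable_add bounded_plus_comp) auto

lemma bounded_borel_diff: "bounded_borel f \<Longrightarrow> bounded_borel g \<Longrightarrow> bounded_borel (\<lambda>x. f x - g x)"
  unfolding bounded_borel_def by (intro conjI borel_measurable_diff bounded_minus_comp) auto

lemma bounded_borel_mult:
  assumes "bounded_borel f" "bounded_borel g"
  shows "bounded_borel (\<lambda>x. f x * g x)"
proof -
  obtain B C where "\<And>x. \<bar>f x\<bar> \<le> B" "\<And>x. \<bar>g x\<bar> \<le> C"
    using assms by (metis bounded_borel_bound)
  then have "\<bar>f x * g x\<bar> \<le> B * C" for x
    by (simp add: abs_mult mult_mono')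
  then have "bounded (range (\<lambda>x. f x * g x))"
    unfolding bounded_real by blast
  then show ?thesis
    using assms unfolding bounded_borel_def by (auto intro: borel_measurable_times)
qed

lemma bounded_borel_power: "bounded_borel f \<Longrightarrow> bounded_borel (\<lambda>x. f x ^ n)"
  by (induction n) (simp_all add: bounded_borel_const bounded_borel_mult)

lemmas bounded_borel_intros =
  bounded_borel_const bounded_borel_add bounded_borel_diff bounded_borel_mult bounded_borel_power

lemma bounded_borel_periodic:
  fixes f :: "real \<Rightarrow> real"
  assumes "p > 0" and periodic: "\<And>x. f (x + p) = f x" and cont: "continuous_on UNIV f"
  shows "bounded_borel f"
proof -
  have "f x \<in> f ` {0..p}" for x
    using periodic_rmod[of p f, OF assms(1) periodic] assms(1)
    by (metis atLeastAtMost_iff image_eqI less_irrefl rmod_le rmod_nonneg)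
  then have "range f \<subseteq> f ` {0..p}"
    by blast
  moreover have "bounded (f ` {0..p})"
    by (intro compact_imp_bounded compact_continuous_image continuous_on_subset[OF cont]) auto
  ultimately have "bounded (range f)"
    by (rule bounded_subset[rotated])
  then show ?thesis
    by (simp add: bounded_borel_def borel_measurable_continuous_onI cont)
qed

lemma bounded_borel_absolutely_integrable:
  fixes f :: "real \<Rightarrow> real"
  assumes "bounded_borel f"
  shows "f absolutely_integrable_on {a..b}"
proof -
  obtain B where B: "\<And>x. \<bar>f x\<bar> \<le> B"
    using bounded_borel_bound[OF assms] by blast
  have "f \<in> borel_measurable (lebesgue_on {a..b})"
    using bounded_borel_measurable[OF assms]
    by (intro measurable_restrict_space1 measurable_completion) simp
  then show ?thesis
    by (rule measurable_bounded_by_integrable_imp_absolutely_integrable[where g = "\<lambda>_. B"])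
       (use B in auto)
qed

lemma bounded_borel_integrable_on:
  fixes f :: "real \<Rightarrow> real"
  assumes "bounded_borel f"
  shows "f integrable_on {a..b}"
  using bounded_borel_absolutely_integrable[OF assms] set_lebesgue_integral_eq_integral(1) by blast

lemma bounded_borel_mult_continuous_integrable_on:
  fixes f u :: "real \<Rightarrow> real"
  assumes f: "bounded_borel f" and u: "continuous_on {a..b} u"
  shows "(\<lambda>x. u x * f x) integrable_on {a..b}"
proof -
  have "(\<lambda>x. u x * f x) absolutely_integrable_on {a..b}"
  proof (rule absolutely_integrable_bounded_measurable_product_real)
    show "u \<in> borel_measurable (lebesgue_on {a..b})"
      by (rule continuous_imp_measurable_on_sets_lebesgue[OF u]) simp
    show "bounded (u ` {a..b})"
      by (intro compact_imp_bounded compact_continuous_image u compact_Icc)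
  qed (simp_all add: bounded_borel_absolutely_integrable f)
  then show ?thesis
    using set_lebesgue_integral_eq_integral(1) by blast
qed

section \<open>Indefinite integrals\<close>

definition indefinite_integral :: "(real \<Rightarrow> real) \<Rightarrow> (real \<Rightarrow> real) \<Rightarrow> bool" where
  "indefinite_integral f F \<longleftrightarrow> (\<forall>a b. a \<le> b \<longrightarrow> (f has_integral F b - F a) {a..b})"

lemma indefinite_integralI:
  "(\<And>a b. a \<le> b \<Longrightarrow> (f has_integral F b - F a) {a..b}) \<Longrightarrow> indefinite_integral f F"
  by (simp add: indefinite_integral_def)

lemma indefinite_integralD:
  "indefinite_integral f F \<Longrightarrow> a \<le> b \<Longrightarrow> (f has_integral F b - F a) {a..b}"
  by (simp add: indefinite_integral_def)

lemma indefinite_integral_of_DERIV: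
  assumes "\<And>x. (F has_real_derivative f x) (at x)"
  shows "indefinite_integral f F"
  using assms
  by (intro indefinite_integralI fundamental_theorem_of_calculus)
     (auto simp: has_field_derivative_at_within simp flip: has_real_derivative_iff_has_vector_derivative)

lemma indefinite_integral_add:
  "indefinite_integral f F \<Longrightarrow> indefinite_integral g G \<Longrightarrow>
    indefinite_integral (\<lambda>x. f x + g x) (\<lambda>x. F x + G x)"
  unfolding indefinite_integral_def add_diff_add by (blast intro: has_integral_add)

lemma indefinite_integral_cmult:
  "indefinite_integral f F \<Longrightarrow> indefinite_integral (\<lambda>x. c * f x) (\<lambda>x. c * F x)"
  unfolding indefinite_integral_def
  by (auto simp flip: right_diff_distrib intro: has_integral_mult_right)

lemma indefinite_integral_shift:
  assumes "indefinite_integral f F"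
  shows "indefinite_integral (\<lambda>x. f (x + p)) (\<lambda>x. F (x + p))"
proof (rule indefinite_integralI)
  fix a b :: real assume "a \<le> b"
  then have "(f has_integral F (b + p) - F (a + p)) {a + p..b + p}"
    by (intro indefinite_integralD[OF assms]) simp
  then show "((\<lambda>x. f (x + p)) has_integral F (b + p) - F (a + p)) {a..b}"
    using has_integral_shift_real_ivl[of f _ "a + p" "b + p" p] by simp
qed

lemma indefinite_integral_unique:
  assumes "indefinite_integral f F" "indefinite_integral f G"
  shows "F x - F y = G x - G y"
proof -
  have "F b - F a = G b - G a" if "a \<le> b" for a b
    using assms that by (meson has_integral_unique indefinite_integralD)
  from this[of x y] this[of y x] show ?thesis
    by (cases x y rule: le_cases) linarith+
qed

lemma indefinite_integral_periodic:
  assumes F: "indefinite_integral f F" and "p \<ge> 0" and periodic: "\<And>x. f (x + p) = f x"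
    and mean: "integral {0..p} f = 0"
  shows "F (x + p) = F x"
proof -
  have "F p - F 0 = 0"
    using indefinite_integralD[OF F assms(2)] mean by (simp add: has_integral_iff)
  moreover have "F (x + p) - F (0 + p) = F x - F 0"
    using indefinite_integral_shift[OF F, of p] F periodic by (intro indefinite_integral_unique) simp_all
  ultimately show ?thesis
    by simp
qed

lemma has_integral_zero_of_periodic:
  assumes "indefinite_integral f F" "p \<ge> 0" "\<And>x. F (x + p) = F x"
  shows "(f has_integral 0) {0..p}"
  using indefinite_integralD[OF assms(1,2)] assms(3)[of 0] by simp

lemma ex_indefinite_integral:
  assumes f: "\<And>a b. f integrable_on {a..b}"
  obtains F where "indefinite_integral f F"
proof
  have combine: "integral {a..b} f + integral {b..c} f = integral {a..c} f"
    if "a \<le> b" "b \<le> c" for a b c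
    by (rule Henstock_Kurzweil_Integration.integral_combine[OF that f])
  let ?F = "\<lambda>x. integral {0..x} f - integral {x..0} f"
  show "indefinite_integral f ?F"
  proof (rule indefinite_integralI)
    fix a b :: real assume "a \<le> b"
    consider "0 \<le> a" | "a \<le> 0" "0 \<le> b" | "b \<le> 0"
      by linarith
    then have "integral {a..b} f = ?F b - ?F a"
      using \<open>a \<le> b\<close> combine[of 0 a b] combine[of a 0 b] combine[of a b 0]
      by cases (auto simp: integral_singleton le_less)
    then show "(f has_integral ?F b - ?F a) {a..b}"
      using f[of a b] by (simp add: has_integral_iff)
  qed
qed

lemma indefinite_integral_lipschitz:
  assumes F: "indefinite_integral f F" and bound: "\<And>x. \<bar>f x\<bar> \<le> B"
  shows "B-lipschitz_on UNIV F"
proof (rule lipschitz_onI)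
  show B: "0 \<le> B"
    using bound[of 0] by linarith
  have "\<bar>F b - F a\<bar> \<le> B * (b - a)" if "a \<le> b" for a b
    using has_integral_bound_real[OF B finite.emptyI indefinite_integralD[OF F that]] bound that
    by simp
  then have "dist (F x) (F y) \<le> B * dist x y" if "x \<le> y" for x y
    using that by (simp add: dist_real_def abs_minus_commute)
  then show "dist (F x) (F y) \<le> B * dist x y" for x y
    by (metis dist_commute linear)
qed

lemma continuous_on_indefinite_integral:
  assumes "indefinite_integral f F" "bounded_borel f"
  shows "continuous_on S F"
proof -
  obtain B where "\<And>x. \<bar>f x\<bar> \<le> B"
    using bounded_borel_bound[OF assms(2)] by blast
  then have "B-lipschitz_on UNIV F"
    by (rule indefinite_integral_lipschitz[OF assms(1)])
  then show ?thesis
    by (rule continuous_on_subset[OF lipschitz_on_continuous_on]) simp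
qed

lemma constant_of_quadratic_increments:
  fixes D :: "real \<Rightarrow> real"
  assumes "\<And>x y. x \<le> y \<Longrightarrow> \<bar>D y - D x\<bar> \<le> C * (y - x)\<^sup>2"
  shows "D x = D y"
proof (rule DERIV_isconst_all[of D], rule allI)
  fix x
  have quotient_bound: "\<bar>(D y - D x) / (y - x)\<bar> \<le> C * \<bar>y - x\<bar>" if "y \<noteq> x" for y
  proof -
    have "\<bar>D y - D x\<bar> \<le> C * (y - x)\<^sup>2"
      using assms[of x y] assms[of y x]
      by (cases x y rule: le_cases) (auto simp: abs_minus_commute power2_commute)
    then have "\<bar>D y - D x\<bar> \<le> C * \<bar>y - x\<bar> * \<bar>y - x\<bar>"
      by (simp add: power2_eq_square mult.assoc flip: abs_mult)
    then show ?thesis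
      using that by (simp add: abs_divide divide_le_eq)
  qed
  have "((\<lambda>y. (D y - D x) / (y - x)) \<longlongrightarrow> 0) (at x)"
  proof (rule Lim_null_comparison)
    show "\<forall>\<^sub>F y in at x. norm ((D y - D x) / (y - x)) \<le> C * \<bar>y - x\<bar>"
      unfolding eventually_at_filter using quotient_bound by simp
    show "((\<lambda>y. C * \<bar>y - x\<bar>) \<longlongrightarrow> 0) (at x)"
      by (auto intro!: tendsto_eq_intros)
  qed
  then show "(D has_real_derivative 0) (at x)"
    by (simp add: has_field_derivative_iff)
qed

lemma product_rule_defect_le:
  assumes F: "indefinite_integral f F" and G: "indefinite_integral g G"
    and K: "indefinite_integral (\<lambda>t. f t * G t + F t * g t) K"
    and Bf: "\<And>x. \<bar>f x\<bar> \<le> Bf" and Bg: "\<And>x. \<bar>g x\<bar> \<le> Bg" and xy: "x \<le> y"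
  shows "\<bar>(F y * G y - K y) - (F x * G x - K x)\<bar> \<le> 2 * Bf * Bg * (y - x)\<^sup>2"
proof -
  have nonneg: "0 \<le> Bf" "0 \<le> Bg"
    using Bf[of 0] Bg[of 0] by linarith+
  have F_lip: "\<bar>F s - F t\<bar> \<le> Bf * \<bar>s - t\<bar>" and G_lip: "\<bar>G s - G t\<bar> \<le> Bg * \<bar>s - t\<bar>" for s t
    using indefinite_integral_lipschitz[OF F Bf] indefinite_integral_lipschitz[OF G Bg]
    by (auto simp: lipschitz_on_def dist_real_def)
  have "((\<lambda>t. f t * G y + F x * g t) has_integral (F y - F x) * G y + F x * (G y - G x)) {x..y}"
    by (intro has_integral_add has_integral_mult_left has_integral_mult_right
        indefinite_integralD[OF F] indefinite_integralD[OF G] xy)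
  from has_integral_diff[OF this indefinite_integralD[OF K xy]]
  have "((\<lambda>t. f t * (G y - G t) + (F x - F t) * g t) has_integral
      (F y * G y - K y) - (F x * G x - K x)) {x..y}"
    by (simp add: algebra_simps)
  moreover have "norm (f t * (G y - G t) + (F x - F t) * g t) \<le> 2 * Bf * Bg * (y - x)"
    if "t \<in> {x..y}" for t
  proof -
    have "\<bar>f t * (G y - G t)\<bar> \<le> Bf * (Bg * (y - x))"
      unfolding abs_mult using that nonneg
      by (intro mult_mono Bf order_trans[OF G_lip] mult_left_mono) auto
    moreover have "\<bar>(F x - F t) * g t\<bar> \<le> (Bf * (y - x)) * Bg"
      unfolding abs_mult using that nonneg
      by (intro mult_mono Bg order_trans[OF F_lip] mult_left_mono) auto
    ultimately show ?thesis
      using abs_triangle_ineq[of "f t * (G y - G t)" "(F x - F t) * g t"] by (simp add: algebra_simps)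
  qed
  ultimately have "norm ((F y * G y - K y) - (F x * G x - K x))
      \<le> 2 * Bf * Bg * (y - x) * measure lborel {x..y}"
    using xy nonneg by (intro has_integral_bound_real[of _ "{}"]) auto
  then show ?thesis
    using xy by (simp add: power2_eq_square mult.assoc)
qed

text \<open>Since the defect of the product rule has quadratic increments, no almost everywhere
  differentiation is needed.\<close>
lemma indefinite_integral_mult:
  assumes F: "indefinite_integral f F" and G: "indefinite_integral g G"
    and f: "bounded_borel f" and g: "bounded_borel g"
  shows "indefinite_integral (\<lambda>x. f x * G x + F x * g x) (\<lambda>x. F x * G x)"
    (is "indefinite_integral ?h _")
proof -
  have "(\<lambda>x. G x * f x + F x * g x) integrable_on {a..b}" for a b
    by (intro Henstock_Kurzweil_Integration.integrable_add bounded_borel_mult_continuous_integrable_on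
        f g continuous_on_indefinite_integral[OF F f] continuous_on_indefinite_integral[OF G g])
  then have "?h integrable_on {a..b}" for a b
    by (simp add: mult.commute)
  then obtain K where K: "indefinite_integral ?h K"
    by (rule ex_indefinite_integral)
  obtain Bf Bg where "\<And>x. \<bar>f x\<bar> \<le> Bf" "\<And>x. \<bar>g x\<bar> \<le> Bg"
    using f g by (metis bounded_borel_bound)
  then have "F a * G a - K a = F b * G b - K b" for a b
    by (rule constant_of_quadratic_increments[OF product_rule_defect_le[OF F G K]])
  then have "F b * G b - F a * G a = K b - K a" for a b
    by (simp add: algebra_simps)
  then show ?thesis
    using K by (simp add: indefinite_integral_def)
qed

lemma DERIV_indefinite_integral:
  assumes F: "indefinite_integral f F" and f: "AE t in lborel. t \<in> S \<longrightarrow> f t = u t"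
    and S: "open S" "x \<in> S" and u: "continuous_on S u"
  shows "(F has_real_derivative u x) (at x)"
proof -
  obtain e where e: "e > 0" "cball x e \<subseteq> S"
    using S by (meson open_contains_cball)
  define a b where "a = x - e" and "b = x + e"
  have x: "x \<in> {a<..<b}" and ab: "{a..b} \<subseteq> S"
    using e by (auto simp: a_def b_def cball_eq_atLeastAtMost)
  have F_eq: "F a + integral {a..y} u = F y" if "y \<in> {a..b}" for y
  proof -
    have "AE t in lborel. t \<in> {a..y} \<longrightarrow> f t = u t"
      using f by eventually_elim (use ab that in force)
    then have "(u has_integral F y - F a) {a..y}"
      using has_integral_AE[of "{a..y}" f u] indefinite_integralD[OF F, of a y] that by simp
    then show ?thesis
      by (simp add: integral_unique)
  qed
  have "((\<lambda>y. F a + integral {a..y} u) has_real_derivative u x) (at x within {a..b})"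
    using integral_has_real_derivative[OF continuous_on_subset[OF u ab], of x] x
    by (auto intro!: derivative_eq_intros)
  then have "(F has_real_derivative u x) (at x within {a..b})"
    by (rule has_field_derivative_transform_within[OF _ zero_less_one _ F_eq]) (use x in auto)
  then show ?thesis
    using x by (simp add: at_within_Icc_at)
qed

text \<open>The density \<open>1 + f / B \<ge> 0\<close> gives every box its Lebesgue measure, so it equals 1 almost
  everywhere.\<close>
lemma AE_zero_of_indefinite_integral_const:
  assumes F: "indefinite_integral f (\<lambda>x. c)" and f: "bounded_borel f"
  shows "AE x in lborel. f x = 0"
proof -
  obtain B where B: "B > 0" "\<And>x. \<bar>f x\<bar> \<le> B"
    using bounded_borel_bound[OF f] by blast
  define h where "h x = 1 + f x / B" for x
  have [measurable]: "h \<in> borel_measurable borel"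
    unfolding h_def using bounded_borel_measurable[OF f] by measurable
  have h_nonneg: "0 \<le> h x" for x
    using B(1) B(2)[of x] by (simp add: h_def field_simps abs_le_iff)
  have "lborel = density lborel (\<lambda>x. ennreal (h x))"
  proof (rule lborel_eqI)
    fix l u :: real assume "\<And>b. b \<in> Basis \<Longrightarrow> l \<bullet> b \<le> u \<bullet> b"
    then have "l \<le> u"
      by simp
    have "(h has_integral (u - l) + 0 / B) {l..u}"
      unfolding h_def
      using \<open>l \<le> u\<close> has_integral_const_real[of "1::real" l u] indefinite_integralD[OF F, of l u]
      by (intro has_integral_add has_integral_divide) auto
    then have "((\<lambda>x. if x \<in> box l u then h x else 0) has_integral (u - l)) UNIV"
      by (simp only: has_integral_restrict_UNIV box_real has_integral_Icc_iff_Ioo) simp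
    then have "(\<integral>\<^sup>+ x. ennreal (if x \<in> box l u then h x else 0) \<partial>lborel) = ennreal (u - l)"
      by (intro nn_integral_has_integral_lborel) (use h_nonneg in auto)
    moreover have "ennreal (h x) * indicator (box l u) x = ennreal (if x \<in> box l u then h x else 0)"
      for x
      by (simp add: indicator_def)
    ultimately show "emeasure (density lborel (\<lambda>x. ennreal (h x))) (box l u)
        = ennreal (\<Prod>b\<in>Basis. (u - l) \<bullet> b)"
      by (simp add: emeasure_density)
  qed simp
  then have "density lborel (\<lambda>x. ennreal (h x)) = density lborel (\<lambda>_::real. 1)"
    by (simp add: density_1)
  then have "AE x in lborel. ennreal (h x) = 1"
    by (intro sigma_finite_measure.density_unique[OF sigma_finite_lborel]) auto
  then show ?thesis
    by eventually_elim (use B(1) in \<open>simp add: h_def\<close>)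
qed

section \<open>Smooth periodic test functions\<close>

lemma smooth_periodic_deriv:
  assumes "smooth_periodic \<phi>"
  shows "smooth_periodic (deriv \<phi>)"
proof -
  have "(deriv ^^ n) (deriv \<phi>) differentiable (at x)" for n x
    using assms unfolding smooth_periodic_def by (metis funpow_Suc_right o_apply)
  then show ?thesis
    using assms deriv_periodic[of \<phi> "2 * pi"] by (simp add: smooth_periodic_def)
qed

lemma smooth_periodic_DERIV:
  assumes "smooth_periodic \<phi>"
  shows "(\<phi> has_real_derivative deriv \<phi> x) (at x)"
proof -
  have "(deriv ^^ 0) \<phi> differentiable (at x)"
    using assms unfolding smooth_periodic_def by blast
  then show ?thesis
    by (simp add: DERIV_deriv_iff_real_differentiable)
qed

lemma smooth_periodic_indefinite_integral:
  "smooth_periodic \<phi> \<Longrightarrow> indefinite_integral (deriv \<phi>) \<phi>"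
  by (intro indefinite_integral_of_DERIV smooth_periodic_DERIV)

lemma smooth_periodic_bounded_borel:
  assumes "smooth_periodic \<phi>"
  shows "bounded_borel \<phi>"
proof (rule bounded_borel_periodic)
  show "continuous_on UNIV \<phi>"
    using smooth_periodic_DERIV[OF assms] by (meson DERIV_isCont continuous_at_imp_continuous_on)
qed (use assms in \<open>auto simp: smooth_periodic_def\<close>)

lemma smooth_periodic_of_DERIV:
  assumes "smooth_periodic \<phi>" and deriv: "\<And>x. (\<Phi> has_real_derivative \<phi> x) (at x)"
    and periodic: "\<And>x. \<Phi> (x + 2 * pi) = \<Phi> x"
  shows "smooth_periodic \<Phi>"
proof -
  have deriv_eq: "deriv \<Phi> = \<phi>"
    using deriv by (auto intro: DERIV_imp_deriv)
  have "(deriv ^^ n) \<Phi> differentiable (at x)" for n x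
  proof (cases n)
    case 0
    then show ?thesis
      using deriv real_differentiable_def by auto
  next
    case (Suc k)
    then show ?thesis
      using assms(1) deriv_eq by (simp add: smooth_periodic_def funpow_swap1)
  qed
  then show ?thesis
    using periodic by (simp add: smooth_periodic_def)
qed

lemma smooth_periodic_diff_const:
  assumes "smooth_periodic \<phi>"
  shows "smooth_periodic (\<lambda>x. \<phi> x - c)"
  using smooth_periodic_DERIV[OF assms] assms
  by (intro smooth_periodic_of_DERIV[OF smooth_periodic_deriv[OF assms]])
     (auto intro!: derivative_eq_intros simp: smooth_periodic_def)

lemma smooth_periodic_antiderivative:
  assumes \<phi>: "smooth_periodic \<phi>" and mean: "integral {0..2 * pi} \<phi> = 0"
  obtains \<Phi> where "smooth_periodic \<Phi>" "deriv \<Phi> = \<phi>"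
proof -
  have bounded: "bounded_borel \<phi>"
    by (rule smooth_periodic_bounded_borel[OF \<phi>])
  obtain \<Phi> where \<Phi>: "indefinite_integral \<phi> \<Phi>"
    using ex_indefinite_integral bounded_borel_integrable_on[OF bounded] by blast
  have "continuous_on UNIV \<phi>"
    using continuous_on_indefinite_integral smooth_periodic_indefinite_integral[OF \<phi>]
      smooth_periodic_bounded_borel[OF smooth_periodic_deriv[OF \<phi>]] by blast
  then have deriv: "(\<Phi> has_real_derivative \<phi> x) (at x)" for x
    by (intro DERIV_indefinite_integral[OF \<Phi>, where S = UNIV]) auto
  have "\<Phi> (x + 2 * pi) = \<Phi> x" for x
    using \<phi> by (intro indefinite_integral_periodic[OF \<Phi> _ _ mean]) (simp_all add: smooth_periodic_def)
  then have "smooth_periodic \<Phi>"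
    by (rule smooth_periodic_of_DERIV[OF \<phi> deriv])
  moreover have "deriv \<Phi> = \<phi>"
    using deriv by (auto intro: DERIV_imp_deriv)
  ultimately show thesis
    by (rule that)
qed

lemma real_polynomial_function_cis_DERIV:
  assumes "real_polynomial_function P"
  shows "\<exists>R. real_polynomial_function R \<and> (\<forall>x. ((\<lambda>x. P (cis x)) has_real_derivative R (cis x)) (at x))"
  using assms
proof induction
  case (linear f)
  then interpret bounded_linear f .
  have "((\<lambda>x. f (cis x)) has_derivative (\<lambda>h. f (h *\<^sub>R (\<i> * cis x)))) (at x)" for x
    by (intro has_derivative has_derivative_cis has_derivative_ident)
  then have "((\<lambda>x. f (cis x)) has_real_derivative f (\<i> * cis x)) (at x)" for x
    by (simp add: has_field_derivative_def scaleR mult_commute_abs)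
  moreover have "bounded_linear (\<lambda>z. f (\<i> * z))"
    by (intro bounded_linear_compose[OF linear.hyps] bounded_linear_mult_right)
  ultimately show ?case
    by blast
next
  case (const c)
  show ?case
    by (auto intro!: exI[of _ "\<lambda>z. 0"])
next
  case (add P Q)
  then obtain P' Q' where "real_polynomial_function P'" "real_polynomial_function Q'"
    "\<And>x. ((\<lambda>x. P (cis x)) has_real_derivative P' (cis x)) (at x)"
    "\<And>x. ((\<lambda>x. Q (cis x)) has_real_derivative Q' (cis x)) (at x)"
    by blast
  then show ?case
    by (intro exI[of _ "\<lambda>z. P' z + Q' z"])
       (auto intro: DERIV_add)
next
  case (mult P Q)
  then obtain P' Q' where "real_polynomial_function P'" "real_polynomial_function Q'"
    "\<And>x. ((\<lambda>x. P (cis x)) has_real_derivative P' (cis x)) (at x)"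
    "\<And>x. ((\<lambda>x. Q (cis x)) has_real_derivative Q' (cis x)) (at x)"
    by blast
  with mult.hyps show ?case
    by (intro exI[of _ "\<lambda>z. P' z * Q z + Q' z * P z"])
       (auto intro: DERIV_mult)
qed

lemma smooth_periodic_real_polynomial_cis:
  assumes "real_polynomial_function P"
  shows "smooth_periodic (\<lambda>x. P (cis x))"
proof -
  have iterate: "\<exists>R. real_polynomial_function R \<and> (deriv ^^ n) (\<lambda>x. P (cis x)) = (\<lambda>x. R (cis x))" for n
  proof (induction n)
    case 0
    show ?case
      using assms by auto
  next
    case (Suc n)
    then obtain R where R: "real_polynomial_function R"
      "(deriv ^^ n) (\<lambda>x. P (cis x)) = (\<lambda>x. R (cis x))"
      by blast
    obtain S where S: "real_polynomial_function S"
      "\<And>x. ((\<lambda>x. R (cis x)) has_real_derivative S (cis x)) (at x)"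
      using real_polynomial_function_cis_DERIV[OF R(1)] by blast
    then have "deriv (\<lambda>x. R (cis x)) = (\<lambda>x. S (cis x))"
      by (auto intro: DERIV_imp_deriv)
    with R S show ?case
      by auto
  qed
  have "(deriv ^^ n) (\<lambda>x. P (cis x)) differentiable (at x)" for n x
    using iterate[of n] real_polynomial_function_cis_DERIV real_differentiable_def by metis
  moreover have "cis (x + 2 * pi) = cis x" for x
    by (simp add: complex_eq_iff)
  ultimately show ?thesis
    by (simp add: smooth_periodic_def)
qed

lemma continuous_periodic_factors_through_cis:
  fixes w :: "real \<Rightarrow> 'a::topological_space"
  assumes cont: "continuous_on UNIV w" and periodic: "\<And>x. w (x + 2 * pi) = w x"
  obtains u where "continuous_on (sphere 0 1) u" "\<And>x. u (cis x) = w x"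
proof -
  define u where "u z = w (Arg2pi z)" for z
  interpret periodic_fun_simple w "2 * pi"
    by unfold_locales (rule periodic)
  have u_cis: "u (cis x) = w x" for x
  proof -
    have "cis (Arg2pi (cis x)) = cis x"
      using Arg2pi_eq[of "cis x"] by (simp add: cis_conv_exp)
    then obtain n :: int where "Arg2pi (cis x) = x + 2 * pi * n"
      using sin_cos_eq_iff[of "Arg2pi (cis x)" x] by (auto simp: complex_eq_iff)
    then show ?thesis
      using plus_of_int[of x n] by (simp add: u_def mult.commute)
  qed
  have circle: "\<exists>x \<in> {0..2 * pi}. z = cis x" if "z \<in> sphere 0 1" for z
    using Arg2pi_eq[of z] Arg2pi_ge_0[of z] Arg2pi_lt_2pi[of z] that
    by (intro bexI[of _ "Arg2pi z"]) (auto simp: cis_conv_exp)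
  have "closed (u -` B \<inter> sphere 0 1)" if "closed B" for B
  proof -
    have "closed (w -` B)"
      using cont that by (simp add: continuous_on_closed_vimage)
    then have "compact (cis ` (w -` B \<inter> {0..2 * pi}))"
      by (intro compact_continuous_image closed_Int_compact compact_Icc)
         (auto intro!: continuous_intros)
    moreover have "u -` B \<inter> sphere 0 1 = cis ` (w -` B \<inter> {0..2 * pi})"
      using circle by (fastforce simp: u_cis)
    ultimately show ?thesis
      by (simp add: compact_imp_closed)
  qed
  then have "continuous_on (sphere 0 1) u"
    by (simp add: continuous_on_closed_vimage)
  then show thesis
    using that u_cis by blast
qed

lemma smooth_periodic_dense:
  assumes "continuous_on UNIV w" "\<And>x. w (x + 2 * pi) = w x" "e > 0"
  obtains \<phi> where "smooth_periodic \<phi>" "\<And>x. \<bar>w x - \<phi> x\<bar> < e"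
proof -
  obtain u where u: "continuous_on (sphere 0 1) u" "\<And>x. u (cis x) = w x"
    using continuous_periodic_factors_through_cis[OF assms(1,2)] by blast
  obtain P where P: "real_polynomial_function P" "\<And>z. z \<in> sphere 0 1 \<Longrightarrow> \<bar>u z - P z\<bar> < e"
    using Stone_Weierstrass_real_polynomial_function[OF compact_sphere u(1) assms(3)] by blast
  have "\<bar>w x - P (cis x)\<bar> < e" for x
    using P(2)[of "cis x"] u(2) by simp
  then show thesis
    by (rule that[OF smooth_periodic_real_polynomial_cis[OF P(1)]])
qed

lemma integral_square_zero_of_orthogonal_smooth_periodic:
  assumes cont: "continuous_on UNIV w" and periodic: "\<And>x. w (x + 2 * pi) = w x"
    and orth: "\<And>\<phi>. smooth_periodic \<phi> \<Longrightarrow> integral {0..2 * pi} (\<lambda>x. w x * \<phi> x) = 0"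
  shows "integral {0..2 * pi} (\<lambda>x. w x * w x) = 0"
proof (rule antisym)
  have w: "bounded_borel w"
    by (rule bounded_borel_periodic[OF _ periodic cont]) simp
  then obtain B where B: "B > 0" "\<And>x. \<bar>w x\<bar> \<le> B"
    by (rule bounded_borel_bound) blast
  show "integral {0..2 * pi} (\<lambda>x. w x * w x) \<le> 0"
  proof (rule field_le_epsilon)
    fix e :: real assume "e > 0"
    define d where "d = e / (2 * pi * B)"
    have "d > 0"
      using \<open>e > 0\<close> B(1) by (simp add: d_def)
    then obtain \<phi> where \<phi>: "smooth_periodic \<phi>" "\<And>x. \<bar>w x - \<phi> x\<bar> < d"
      using smooth_periodic_dense[OF cont periodic] by blast
    have integrable: "(\<lambda>x. w x * w x) integrable_on {0..2 * pi}"
      "(\<lambda>x. w x * \<phi> x) integrable_on {0..2 * pi}"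
      by (intro bounded_borel_integrable_on bounded_borel_mult w smooth_periodic_bounded_borel \<phi>)+
    have "integral {0..2 * pi} (\<lambda>x. w x * w x) = integral {0..2 * pi} (\<lambda>x. w x * w x - w x * \<phi> x)"
      using orth[OF \<phi>(1)] by (simp add: Henstock_Kurzweil_Integration.integral_diff[OF integrable])
    also have "\<dots> \<le> integral {0..2 * pi} (\<lambda>x. B * d)"
    proof (rule integral_le)
      have "\<bar>w x * (w x - \<phi> x)\<bar> \<le> B * d" for x
        unfolding abs_mult using B less_imp_le[OF \<phi>(2)] by (intro mult_mono) auto
      then show "w x * w x - w x * \<phi> x \<le> B * d" for x
        unfolding right_diff_distrib using abs_le_D1 by blast
    qed (auto intro: Henstock_Kurzweil_Integration.integrable_diff integrable)
    also have "\<dots> = 0 + e"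
      using B(1) by (simp add: d_def)
    finally show "integral {0..2 * pi} (\<lambda>x. w x * w x) \<le> 0 + e" .
  qed
  show "0 \<le> integral {0..2 * pi} (\<lambda>x. w x * w x)"
    by (intro Henstock_Kurzweil_Integration.integral_nonneg bounded_borel_integrable_on
        bounded_borel_mult w) simp
qed

lemma zero_of_orthogonal_smooth_periodic:
  assumes cont: "continuous_on UNIV w" and periodic: "\<And>x. w (x + 2 * pi) = w x"
    and orth: "\<And>\<phi>. smooth_periodic \<phi> \<Longrightarrow> integral {0..2 * pi} (\<lambda>x. w x * \<phi> x) = 0"
  shows "w x = 0"
proof -
  have "continuous_on {0..2 * pi} (\<lambda>x. w x * w x)"
    by (intro continuous_on_mult continuous_on_subset[OF cont]) simp_all
  then have "\<forall>x\<in>{0..2 * pi}. w x * w x = 0"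
    using integral_square_zero_of_orthogonal_smooth_periodic[OF cont periodic orth]
    by (subst integral_eq_0_iff[symmetric]) simp_all
  then have "w (x rmod (2 * pi)) = 0"
    using rmod_nonneg[of "2 * pi" x] rmod_le[of "2 * pi" x] by simp
  then show ?thesis
    using periodic_rmod[of "2 * pi" w, OF _ periodic] by simp
qed

section \<open>Vanishing weak derivatives on the circle\<close>

definition circle_mean :: "(real \<Rightarrow> real) \<Rightarrow> real" where
  "circle_mean f = integral {0..2 * pi} f / (2 * pi)"

lemma has_integral_circle_mean:
  "bounded_borel f \<Longrightarrow> (f has_integral 2 * pi * circle_mean f) {0..2 * pi}"
  by (simp add: circle_mean_def has_integral_iff bounded_borel_integrable_on)

lemma has_integral_diff_circle_mean:
  assumes "bounded_borel f"
  shows "((\<lambda>x. f x - circle_mean f) has_integral 0) {0..2 * pi}"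
  using has_integral_diff[OF has_integral_circle_mean[OF assms]
      has_integral_const_real[of "circle_mean f" 0 "2 * pi"]]
  by simp

definition weak_derivative_zero :: "(real \<Rightarrow> real) \<Rightarrow> bool" where
  "weak_derivative_zero f \<longleftrightarrow>
     (\<forall>\<phi>. smooth_periodic \<phi> \<longrightarrow> ((\<lambda>x. f x * deriv \<phi> x) has_integral 0) {0..2 * pi})"

lemma weak_derivative_zero_orthogonal:
  assumes f: "bounded_borel f" and weak: "weak_derivative_zero f" and \<phi>: "smooth_periodic \<phi>"
  shows "((\<lambda>x. (f x - circle_mean f) * \<phi> x) has_integral 0) {0..2 * pi}"
proof -
  let ?c = "circle_mean f" and ?d = "circle_mean \<phi>"
  have \<phi>_mean: "((\<lambda>x. \<phi> x - ?d) has_integral 0) {0..2 * pi}"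
    by (rule has_integral_diff_circle_mean[OF smooth_periodic_bounded_borel[OF \<phi>]])
  then obtain \<Phi> where "smooth_periodic \<Phi>" "deriv \<Phi> = (\<lambda>x. \<phi> x - ?d)"
    using smooth_periodic_antiderivative[OF smooth_periodic_diff_const[OF \<phi>]] by (metis integral_unique)
  then have "((\<lambda>x. f x * (\<phi> x - ?d)) has_integral 0) {0..2 * pi}"
    using weak by (auto simp: weak_derivative_zero_def)
  then have "((\<lambda>x. f x * (\<phi> x - ?d) + ?d * (f x - ?c) - ?c * (\<phi> x - ?d)) has_integral
      0 + ?d * 0 - ?c * 0) {0..2 * pi}"
    by (intro has_integral_add has_integral_diff has_integral_mult_right
        has_integral_diff_circle_mean[OF f] \<phi>_mean)
  then show ?thesis
    by (simp add: algebra_simps)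
qed

lemma weak_derivative_zero_indefinite_integral:
  assumes f: "bounded_borel f" and weak: "weak_derivative_zero f"
    and F: "indefinite_integral (\<lambda>x. f x - circle_mean f) F" and periodic: "\<And>x. F (x + 2 * pi) = F x"
  shows "weak_derivative_zero F"
  unfolding weak_derivative_zero_def
proof (intro allI impI)
  fix \<phi> assume \<phi>: "smooth_periodic \<phi>"
  have "indefinite_integral (\<lambda>x. (f x - circle_mean f) * \<phi> x + F x * deriv \<phi> x) (\<lambda>x. F x * \<phi> x)"
    by (intro indefinite_integral_mult F smooth_periodic_indefinite_integral bounded_borel_intros
        smooth_periodic_bounded_borel smooth_periodic_deriv f \<phi>)
  then have "((\<lambda>x. (f x - circle_mean f) * \<phi> x + F x * deriv \<phi> x) has_integral 0) {0..2 * pi}"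
    by (rule has_integral_zero_of_periodic) (use periodic \<phi> in \<open>simp_all add: smooth_periodic_def\<close>)
  from has_integral_diff[OF this weak_derivative_zero_orthogonal[OF f weak \<phi>]]
  show "((\<lambda>x. F x * deriv \<phi> x) has_integral 0) {0..2 * pi}"
    by simp
qed

text \<open>Orthogonality is used twice: a primitive \<open>F\<close> of \<open>f\<close> minus its mean inherits the vanishing weak
  derivative, and a continuous function can be tested against itself.\<close>
lemma AE_const_of_weak_derivative_zero:
  assumes f: "bounded_borel f" and periodic: "\<And>x. f (x + 2 * pi) = f x"
    and weak: "weak_derivative_zero f"
  shows "AE x in lborel. f x = circle_mean f"
proof -
  have f0: "bounded_borel (\<lambda>x. f x - circle_mean f)"
    by (intro bounded_borel_intros f)
  obtain F where F: "indefinite_integral (\<lambda>x. f x - circle_mean f) F"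
    using ex_indefinite_integral bounded_borel_integrable_on[OF f0] by blast
  have F_periodic: "F (x + 2 * pi) = F x" for x
    using integral_unique[OF has_integral_diff_circle_mean[OF f]]
    by (intro indefinite_integral_periodic[OF F]) (simp_all add: periodic)
  have F_cont: "continuous_on UNIV F"
    by (rule continuous_on_indefinite_integral[OF F f0])
  have F_bounded: "bounded_borel F"
    by (rule bounded_borel_periodic[OF _ F_periodic F_cont]) simp
  have "weak_derivative_zero F"
    by (rule weak_derivative_zero_indefinite_integral[OF f weak F F_periodic])
  then have "integral {0..2 * pi} (\<lambda>x. (F x - circle_mean F) * \<phi> x) = 0" if "smooth_periodic \<phi>" for \<phi>
    using weak_derivative_zero_orthogonal[OF F_bounded _ that] by blast
  then have "F x - circle_mean F = 0" for x
    by (intro zero_of_orthogonal_smooth_periodic[of "\<lambda>x. F x - circle_mean F"] continuous_intros F_cont)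
       (simp_all add: F_periodic)
  then obtain c where "F = (\<lambda>x. c)"
    by (metis eq_iff_diff_eq_0)
  with F have "indefinite_integral (\<lambda>x. f x - circle_mean f) (\<lambda>x. c)"
    by simp
  from AE_zero_of_indefinite_integral_const[OF this f0] show ?thesis
    by simp
qed

section \<open>Jump points\<close>

definition jump_point :: "(real \<Rightarrow> real) \<Rightarrow> real \<Rightarrow> bool" where
  "jump_point g x \<longleftrightarrow> (\<forall>\<epsilon>>0. \<not> ae_const_on g (x - \<epsilon>) (x + \<epsilon>))"

lemma not_jump_pointI:
  assumes "open U" "x \<in> U" and const: "AE y in lborel. y \<in> U \<longrightarrow> g y = c"
  shows "\<not> jump_point g x"
proof -
  obtain \<epsilon> where \<epsilon>: "\<epsilon> > 0" "ball x \<epsilon> \<subseteq> U"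
    using assms(1,2) by (rule openE)
  have "AE y in lborel. y \<in> {x - \<epsilon><..<x + \<epsilon>} \<longrightarrow> g y = c"
    using const by eventually_elim (use \<epsilon>(2) in \<open>auto simp: ball_eq_greaterThanLessThan\<close>)
  with \<epsilon>(1) show ?thesis
    by (auto simp: jump_point_def ae_const_on_def)
qed

lemma AE_const_of_no_jump_point:
  assumes "connected S" and no_jump: "\<And>x. x \<in> S \<Longrightarrow> \<not> jump_point g x"
  shows "\<exists>c. AE y in lborel. y \<in> S \<longrightarrow> g y = c"
proof (rule AE_const_of_locally_AE_const[OF assms(1)])
  fix x assume "x \<in> S"
  then obtain \<epsilon> c where "\<epsilon> > 0" "AE y in lborel. y \<in> {x - \<epsilon><..<x + \<epsilon>} \<longrightarrow> g y = c"
    using no_jump[of x] by (auto simp: jump_point_def ae_const_on_def)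
  then show "\<exists>U c. open U \<and> x \<in> U \<and> (AE y in lborel. y \<in> U \<longrightarrow> g y = c)"
    by (intro exI[of _ "{x - \<epsilon><..<x + \<epsilon>}"]) auto
qed

lemma ae_const_on_translate: "ae_const_on g (a + p) (b + p) \<longleftrightarrow> ae_const_on (\<lambda>x. g (x + p)) a b"
proof -
  have "(AE x in lborel. x \<in> {a + p<..<b + p} \<longrightarrow> g x = c) \<longleftrightarrow>
      (AE x in lborel. x \<in> {a<..<b} \<longrightarrow> g (x + p) = c)" for c
    using AE_lborel_translate_iff[of "\<lambda>x. x \<in> {a + p<..<b + p} \<longrightarrow> g x = c" p]
    by (simp add: add.commute)
  then show ?thesis
    by (simp only: ae_const_on_def)
qed

lemma jump_point_periodic:
  assumes "\<And>x. g (x + p) = g x"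
  shows "jump_point g (x + p) \<longleftrightarrow> jump_point g x"
proof -
  have "ae_const_on g (x + p - \<epsilon>) (x + p + \<epsilon>) \<longleftrightarrow> ae_const_on g (x - \<epsilon>) (x + \<epsilon>)" for \<epsilon>
    using ae_const_on_translate[of g "x - \<epsilon>" p "x + \<epsilon>"] assms by (simp add: algebra_simps)
  then show ?thesis
    by (simp add: jump_point_def)
qed

definition jump_set :: "(real \<Rightarrow> real) \<Rightarrow> real \<Rightarrow> real set" where
  "jump_set g p = {\<theta> \<in> {0..<p}. jump_point g \<theta>}"

lemma jump_point_in_translated_jump_set:
  assumes "p > 0" and periodic: "\<And>x. g (x + p) = g x" and "jump_point g x"
  shows "x \<in> {\<theta> + p * of_int k | \<theta> k. \<theta> \<in> jump_set g p}"
proof -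
  have "jump_point g (x rmod p)"
    using periodic_rmod[of p "jump_point g"] jump_point_periodic[of g p] assms by simp
  then have "x rmod p \<in> jump_set g p"
    using assms(1) by (simp add: jump_set_def rmod_nonneg rmod_less)
  moreover have "x = x rmod p + p * of_int \<lfloor>x / p\<rfloor>"
    using assms(1) by (simp add: rmod_def)
  ultimately show ?thesis
    by blast
qed

lemma AE_const_of_jump_set_empty:
  assumes "p > 0" "\<And>x. g (x + p) = g x" "jump_set g p = {}"
  shows "\<exists>c. AE x in lborel. g x = c"
proof -
  have "\<not> jump_point g x" for x
    using jump_point_in_translated_jump_set[of p g x] assms by blast
  then show ?thesis
    using AE_const_of_no_jump_point[OF connected_UNIV, of g] by simp
qed

lemma ae_const_on_off_jump_set:
  assumes "p > 0" "\<And>x. g (x + p) = g x"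
    and "{a<..<b} \<inter> {\<theta> + p * of_int k | \<theta> k. \<theta> \<in> jump_set g p} = {}"
  shows "ae_const_on g a b"
proof -
  have "\<not> jump_point g x" if "x \<in> {a<..<b}" for x
    using jump_point_in_translated_jump_set[of p g x] assms that by blast
  then show ?thesis
    unfolding ae_const_on_def by (rule AE_const_of_no_jump_point[OF connected_Ioo])
qed

section \<open>Zeros and nodal intervals\<close>

lemma finite_simple_zeros:
  fixes f f' :: "real \<Rightarrow> real"
  assumes "compact S" and deriv: "\<And>x. (f has_real_derivative f' x) (at x)"
    and simple: "\<And>x. f x = 0 \<Longrightarrow> f' x \<noteq> 0"
  shows "finite (S \<inter> {x. f x = 0})"
proof (rule finite_not_islimpt_in_compact[OF assms(1)])
  fix z
  have "\<forall>\<^sub>F x in at z. f x \<noteq> 0"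
  proof (cases "f z = 0")
    case True
    then have "((\<lambda>x. f x / (x - z)) \<longlongrightarrow> f' z) (at z)"
      using deriv[of z] by (simp add: has_field_derivative_iff)
    then have "\<forall>\<^sub>F x in at z. f x / (x - z) \<noteq> 0"
      by (rule tendsto_imp_eventually_ne[OF _ simple[OF True]])
    then show ?thesis
      by eventually_elim auto
  next
    case False
    then show ?thesis
      using DERIV_isCont[OF deriv] by (intro tendsto_imp_eventually_ne) (auto simp: isCont_def)
  qed
  then show "\<not> z islimpt {x. f x = 0}"
    by (simp add: islimpt_iff_eventually)
qed

lemma sgn_eq_of_nonzero_connected:
  fixes f :: "'a::topological_space \<Rightarrow> real"
  assumes "connected S" "continuous_on S f" and nonzero: "\<And>x. x \<in> S \<Longrightarrow> f x \<noteq> 0"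
    and "x \<in> S" "y \<in> S"
  shows "sgn (f x) = sgn (f y)"
proof (rule ccontr)
  assume "sgn (f x) \<noteq> sgn (f y)"
  then have "f x \<le> 0 \<and> 0 \<le> f y \<or> f y \<le> 0 \<and> 0 \<le> f x"
    by (auto simp: sgn_if split: if_splits)
  moreover have "connected (f ` S)"
    by (rule connected_continuous_image[OF assms(2,1)])
  ultimately have "0 \<in> f ` S"
    using assms(4,5) unfolding connected_iff_interval by blast
  then show False
    using nonzero by auto
qed

lemma adjacent_zeros:
  fixes f :: "real \<Rightarrow> real"
  assumes cont: "continuous_on UNIV f" and zeros: "f l = 0" "f r = 0" and "l \<le> x" "x \<le> r" "f x \<noteq> 0"
  obtains a b where "l \<le> a" "a < x" "x < b" "b \<le> r" "f a = 0" "f b = 0"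
    "\<And>y. y \<in> {a<..<b} \<Longrightarrow> f y \<noteq> 0"
proof -
  define L R where "L = {y. f y = 0} \<inter> {..x}" and "R = {y. f y = 0} \<inter> {x..}"
  have "closed {y. f y = 0}"
    by (intro closed_Collect_eq cont continuous_on_const)
  then have "closed L" "closed R"
    by (auto simp: L_def R_def)
  moreover have mem: "l \<in> L" "r \<in> R"
    using assms by (simp_all add: L_def R_def)
  moreover have bdd: "bdd_above L" "bdd_below R"
    by (auto simp: L_def R_def)
  ultimately have ends: "Sup L \<in> L" "Inf R \<in> R"
    by (auto intro!: closed_contains_Sup closed_contains_Inf)
  show thesis
  proof (rule that)
    show "l \<le> Sup L" "Inf R \<le> r"
      by (rule cSup_upper[OF mem(1) bdd(1)], rule cInf_lower[OF mem(2) bdd(2)])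
    show "f (Sup L) = 0" "f (Inf R) = 0" "Sup L < x" "x < Inf R"
      using ends assms(6) by (auto simp: L_def R_def less_le)
    show "f y \<noteq> 0" if "y \<in> {Sup L<..<Inf R}" for y
    proof
      assume "f y = 0"
      then have "y \<in> L \<or> y \<in> R"
        by (auto simp: L_def R_def)
      then show False
        using cSup_upper[OF _ bdd(1)] cInf_lower[OF _ bdd(2)] that by force
    qed
  qed
qed

lemma periodic_nodal_interval:
  fixes f :: "real \<Rightarrow> real"
  assumes cont: "continuous_on UNIV f" and "p > 0" and periodic: "\<And>x. f (x + p) = f x"
    and "f z = 0" "f x \<noteq> 0"
  obtains a b where "a < x" "x < b" "b - a \<le> p" "f a = 0" "f b = 0" "\<And>y. y \<in> {a<..<b} \<Longrightarrow> f y \<noteq> 0"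
proof -
  define r where "r = x + (z - x) rmod p"
  have "f r = 0"
    using periodic_rmod[of p "\<lambda>y. f (x + y)" "z - x"] assms by (simp add: r_def flip: add.assoc)
  moreover from this have "f (r - p) = 0"
    using periodic[of "r - p"] by simp
  moreover have "r - p \<le> x" "x \<le> r"
    using assms(2) rmod_nonneg[of p "z - x"] rmod_le[of p "z - x"] by (simp_all add: r_def)
  ultimately obtain a b where "r - p \<le> a" "a < x" "x < b" "b \<le> r" "f a = 0" "f b = 0"
    "\<And>y. y \<in> {a<..<b} \<Longrightarrow> f y \<noteq> 0"
    using adjacent_zeros[OF cont, of "r - p" r x] assms(5) by blast
  then show thesis
    using that[of a b] by simp
qed

section \<open>Forced oscillators on a nodal interval\<close>

lemma DERIV_nonneg_left_end:
  fixes f :: "real \<Rightarrow> real"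
  assumes "(f has_real_derivative d) (at a)" "a < b" and min: "\<And>x. x \<in> {a<..<b} \<Longrightarrow> f a \<le> f x"
  shows "0 \<le> d"
proof (rule tendsto_lowerbound)
  show "((\<lambda>x. (f x - f a) / (x - a)) \<longlongrightarrow> d) (at_right a)"
    using assms(1) by (auto simp: has_field_derivative_iff intro: tendsto_within_subset)
  show "\<forall>\<^sub>F x in at_right a. 0 \<le> (f x - f a) / (x - a)"
    using eventually_at_right_real[OF assms(2)] by eventually_elim (use min in auto)
qed simp

lemma DERIV_nonpos_right_end:
  fixes f :: "real \<Rightarrow> real"
  assumes "(f has_real_derivative d) (at b)" "a < b" and min: "\<And>x. x \<in> {a<..<b} \<Longrightarrow> f b \<le> f x"
  shows "d \<le> 0"
proof -
  have "((\<lambda>x. f (- x)) has_real_derivative - d) (at (- b))"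
    using assms(1) DERIV_mirror[where f = f and x = "- b" and y = d] by simp
  then have "0 \<le> - d"
    by (rule DERIV_nonneg_left_end[where b = "- a"]) (use assms(2) min in auto)
  then show ?thesis
    by simp
qed

lemma forced_oscillator_force_nonpos:
  fixes u v :: "real \<Rightarrow> real"
  assumes \<omega>: "\<omega> > 0" and ab: "a < b" "b - a \<le> pi / \<omega>"
    and u: "\<And>x. (u has_real_derivative v x) (at x)" and v_cont: "continuous_on {a..b} v"
    and v: "\<And>x. x \<in> {a<..<b} \<Longrightarrow> (v has_real_derivative c - \<omega>\<^sup>2 * u x) (at x)"
    and ends: "u a = 0" "u b = 0" and vb: "v b \<le> 0"
  shows "c \<le> 0"
proof -
  let ?\<theta> = "\<omega> * (b - a)"
  \<comment> \<open>The antiderivative of \<open>\<omega> (u'' + \<omega>\<^sup>2 u - c) sin (\<omega> (x - a))\<close>.\<close>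
  define W where "W x = \<omega> * (v x * sin (\<omega> * (x - a))) + (c - \<omega>\<^sup>2 * u x) * cos (\<omega> * (x - a))" for x
  have "W b = W a"
  proof (rule DERIV_isconst_end[OF ab(1)])
    have "continuous_on {a..b} u"
      using u by (meson DERIV_isCont continuous_at_imp_continuous_on)
    then show "continuous_on {a..b} W"
      unfolding W_def by (intro continuous_intros v_cont)
    show "(W has_real_derivative 0) (at x)" if "a < x" "x < b" for x
      unfolding W_def using that
      by (auto intro!: derivative_eq_intros u v simp: algebra_simps power2_eq_square)
  qed
  then have balance: "c * (1 - cos ?\<theta>) = \<omega> * (v b * sin ?\<theta>)"
    by (simp add: W_def ends algebra_simps)
  have \<theta>: "0 < ?\<theta>" "?\<theta> \<le> pi"
    using \<omega> ab by (simp_all add: field_simps)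
  then have "cos ?\<theta> < cos 0"
    by (intro cos_monotone_0_pi) auto
  moreover have "c * (1 - cos ?\<theta>) \<le> 0"
    unfolding balance using \<omega> vb \<theta>
    by (intro mult_nonneg_nonpos mult_nonpos_nonneg sin_ge_zero) auto
  ultimately show ?thesis
    by (simp add: mult_le_0_iff)
qed

lemma forced_oscillator_nodal_interval:
  fixes u v :: "real \<Rightarrow> real"
  assumes \<omega>: "\<omega> > 0" and ab: "b - a \<le> pi / \<omega>"
    and u: "\<And>x. (u has_real_derivative v x) (at x)" and v_cont: "continuous_on {a..b} v"
    and v: "\<And>x. x \<in> {a<..<b} \<Longrightarrow> (v has_real_derivative c - \<omega>\<^sup>2 * u x) (at x)"
    and ends: "u a = 0" "u b = 0" and nonzero: "\<And>x. x \<in> {a<..<b} \<Longrightarrow> u x \<noteq> 0"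
    and x: "x \<in> {a<..<b}"
  shows "0 \<le> u x * v a" "u x * v b \<le> 0" "u x * c \<le> 0"
proof -
  define s where "s = sgn (u x)"
  have "a < b"
    using x by simp
  have "continuous_on {a<..<b} u"
    using u by (meson DERIV_isCont continuous_at_imp_continuous_on)
  then have "sgn (u y) = s" if "y \<in> {a<..<b}" for y
    unfolding s_def by (rule sgn_eq_of_nonzero_connected[OF connected_Ioo _ nonzero that x])
  then have pos: "0 \<le> s * u y" if "y \<in> {a<..<b}" for y
    using that by (metis abs_ge_zero abs_sgn mult.commute)
  have su: "((\<lambda>y. s * u y) has_real_derivative s * v y) (at y)" for y
    by (intro DERIV_cmult u)
  have left: "0 \<le> s * v a"
    by (rule DERIV_nonneg_left_end[OF su \<open>a < b\<close>]) (simp add: ends pos)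
  have right: "s * v b \<le> 0"
    by (rule DERIV_nonpos_right_end[OF su \<open>a < b\<close>]) (simp add: ends pos)
  have force: "s * c \<le> 0"
  proof (rule forced_oscillator_force_nonpos[OF \<omega> \<open>a < b\<close> ab su _ _ _ _ right])
    show "((\<lambda>y. s * v y) has_real_derivative s * c - \<omega>\<^sup>2 * (s * u y)) (at y)" if "y \<in> {a<..<b}" for y
      using DERIV_cmult[OF v[OF that], of s] by (simp add: algebra_simps)
  qed (auto intro!: continuous_intros v_cont simp: ends)
  have "u x = \<bar>u x\<bar> * s"
    by (simp add: s_def abs_mult_sgn)
  then show "0 \<le> u x * v a" "u x * v b \<le> 0" "u x * c \<le> 0"
    using left right force by (metis abs_ge_zero mult.assoc mult_nonneg_nonneg mult_nonneg_nonpos)+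
qed

section \<open>The first integral\<close>

locale periodic_oscillator =
  fixes \<omega> :: real and g G :: "real \<Rightarrow> real"
  assumes g_bounded_borel: "bounded_borel g"
    and g_periodic: "g (x + 2 * pi) = g x"
    and G_periodic: "G (x + 2 * pi) = G x"
    and G_differentiable: "G differentiable (at x)"
    and oscillator_eq: "a \<le> b \<Longrightarrow> deriv G b - deriv G a = integral {a..b} (\<lambda>x. g x - \<omega>\<^sup>2 * G x)"
begin

abbreviation G' :: "real \<Rightarrow> real" where "G' \<equiv> deriv G"

definition energy :: "real \<Rightarrow> real" where "energy x = (G' x)\<^sup>2 + \<omega>\<^sup>2 * (G x)\<^sup>2"

lemma DERIV_G: "(G has_real_derivative G' x) (at x)"
  using G_differentiable by (simp add: DERIV_deriv_iff_real_differentiable)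

lemma continuous_on_G: "continuous_on S G"
  using DERIV_G by (meson DERIV_isCont continuous_at_imp_continuous_on)

lemma open_nonzero_set: "open {x. G x \<noteq> 0}"
  by (intro open_Collect_neq continuous_on_G continuous_on_const)

lemma G_bounded_borel: "bounded_borel G"
  by (rule bounded_borel_periodic[OF _ G_periodic continuous_on_G]) simp

lemma source_bounded_borel: "bounded_borel (\<lambda>x. g x - \<omega>\<^sup>2 * G x)"
  by (intro bounded_borel_intros g_bounded_borel G_bounded_borel)

lemma G'_indefinite_integral: "indefinite_integral (\<lambda>x. g x - \<omega>\<^sup>2 * G x) G'"
  by (intro indefinite_integralI)
     (simp add: has_integral_iff bounded_borel_integrable_on source_bounded_borel oscillator_eq)

lemma continuous_on_G': "continuous_on S G'"
  by (rule continuous_on_indefinite_integral[OF G'_indefinite_integral source_bounded_borel])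

lemma G'_bounded_borel: "bounded_borel G'"
  by (rule bounded_borel_periodic[of "2 * pi", OF _ deriv_periodic continuous_on_G'])
     (simp_all add: G_periodic)

lemma continuous_on_energy: "continuous_on S energy"
  unfolding energy_def by (intro continuous_intros continuous_on_G continuous_on_G')

lemma energy_bounded_borel: "bounded_borel energy"
  unfolding energy_def by (intro bounded_borel_intros G_bounded_borel G'_bounded_borel)

lemma energy_periodic: "energy (x + 2 * pi) = energy x"
  by (simp add: energy_def G_periodic deriv_periodic[of G])

lemma energy_indefinite_integral: "indefinite_integral (\<lambda>x. 2 * G' x * g x) energy"
proof -
  have "indefinite_integral
      (\<lambda>x. ((g x - \<omega>\<^sup>2 * G x) * G' x + G' x * (g x - \<omega>\<^sup>2 * G x)) + \<omega>\<^sup>2 * (G' x * G x + G x * G' x))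
      (\<lambda>x. G' x * G' x + \<omega>\<^sup>2 * (G x * G x))"
    by (intro indefinite_integral_add indefinite_integral_cmult indefinite_integral_mult
        G'_indefinite_integral indefinite_integral_of_DERIV[OF DERIV_G]
        source_bounded_borel G'_bounded_borel)
  then show ?thesis
    by (simp add: energy_def[abs_def] power2_eq_square algebra_simps)
qed

end

locale steady_oscillator = periodic_oscillator +
  assumes steady: "smooth_periodic \<phi> \<Longrightarrow>
    integral {0..2 * pi} (\<lambda>x. G x * g x * deriv \<phi> x + deriv G x * g x * \<phi> x) = 0"
begin

lemma weak_derivative_zero_first_integral: "weak_derivative_zero (\<lambda>x. 2 * G x * g x - energy x)"
  unfolding weak_derivative_zero_def
proof (intro allI impI)
  fix \<phi> assume \<phi>: "smooth_periodic \<phi>"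
  note \<phi>_bounded_borel = smooth_periodic_bounded_borel[OF \<phi>]
    smooth_periodic_bounded_borel[OF smooth_periodic_deriv[OF \<phi>]]
  have "bounded_borel (\<lambda>x. G x * g x * deriv \<phi> x + G' x * g x * \<phi> x)"
    by (intro bounded_borel_intros g_bounded_borel G_bounded_borel G'_bounded_borel \<phi>_bounded_borel)
  then have weak: "((\<lambda>x. G x * g x * deriv \<phi> x + G' x * g x * \<phi> x) has_integral 0) {0..2 * pi}"
    using steady[OF \<phi>] by (simp add: has_integral_iff bounded_borel_integrable_on)
  have "indefinite_integral (\<lambda>x. 2 * G' x * g x * \<phi> x + energy x * deriv \<phi> x) (\<lambda>x. energy x * \<phi> x)"
    by (intro indefinite_integral_mult energy_indefinite_integral smooth_periodic_indefinite_integral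
        bounded_borel_intros g_bounded_borel G'_bounded_borel \<phi>_bounded_borel \<phi>)
  then have "((\<lambda>x. 2 * G' x * g x * \<phi> x + energy x * deriv \<phi> x) has_integral 0) {0..2 * pi}"
    by (rule has_integral_zero_of_periodic)
       (use \<phi> in \<open>simp_all add: energy_periodic smooth_periodic_def\<close>)
  from has_integral_diff[OF has_integral_mult_right[OF weak, of 2] this]
  show "((\<lambda>x. (2 * G x * g x - energy x) * deriv \<phi> x) has_integral 0) {0..2 * pi}"
    by (simp add: algebra_simps)
qed

lemma ex_first_integral: "\<exists>E. AE x in lborel. 2 * G x * g x = energy x - E"
proof -
  let ?f = "\<lambda>x. 2 * G x * g x - energy x"
  have "bounded_borel ?f"
    by (intro bounded_borel_intros g_bounded_borel G_bounded_borel energy_bounded_borel)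
  then have "AE x in lborel. ?f x = circle_mean ?f"
    by (rule AE_const_of_weak_derivative_zero)
       (simp_all add: g_periodic G_periodic energy_periodic weak_derivative_zero_first_integral)
  then have "AE x in lborel. 2 * G x * g x = energy x - (- circle_mean ?f)"
    by eventually_elim simp
  then show ?thesis
    by blast
qed

end

locale oscillator_level = periodic_oscillator +
  fixes E :: real
  assumes first_integral: "AE x in lborel. 2 * G x * g x = energy x - E"
begin

text \<open>The value of \<open>g\<close> forced by the first integral; a junk value at the zeros of \<open>G\<close>.\<close>
definition profile :: "real \<Rightarrow> real" where "profile x = (energy x - E) / (2 * G x)"

lemma energy_minus_level: "G x \<noteq> 0 \<Longrightarrow> energy x - E = 2 * G x * profile x"
  by (simp add: profile_def)

lemma AE_eq_profile: "AE x in lborel. G x \<noteq> 0 \<longrightarrow> g x = profile x"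
  using first_integral by eventually_elim (auto simp: profile_def eq_divide_eq mult_ac)

lemma energy_at_zero:
  assumes "G x = 0"
  shows "energy x = E"
proof -
  obtain B where B: "\<And>x. \<bar>g x\<bar> \<le> B"
    using bounded_borel_bound[OF g_bounded_borel] by blast
  have "\<bar>energy x - E\<bar> \<le> 2 * \<bar>G x\<bar> * B"
  proof (rule continuous_le_of_AE_le[of "\<lambda>x. \<bar>energy x - E\<bar>" "\<lambda>x. 2 * \<bar>G x\<bar> * B"])
    show "AE x in lborel. \<bar>energy x - E\<bar> \<le> 2 * \<bar>G x\<bar> * B"
      using first_integral
    proof eventually_elim
      case (elim x)
      have "\<bar>energy x - E\<bar> = 2 * \<bar>G x\<bar> * \<bar>g x\<bar>"
        by (simp add: abs_mult flip: elim)
      then show ?case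
        using B[of x] by (simp add: mult_left_mono)
    qed
  qed (intro continuous_intros continuous_on_energy continuous_on_G)+
  then show ?thesis
    using assms by simp
qed

lemma abs_G'_at_zero:
  assumes "G x = 0"
  shows "\<bar>G' x\<bar> = sqrt E"
  using energy_at_zero[OF assms] assms by (auto simp: energy_def)

lemma DERIV_G'_off_zeros:
  assumes "G x \<noteq> 0"
  shows "(G' has_real_derivative profile x - \<omega>\<^sup>2 * G x) (at x)"
proof (rule DERIV_indefinite_integral[OF G'_indefinite_integral])
  show "open {x. G x \<noteq> 0}"
    by (rule open_nonzero_set)
  show "AE t in lborel. t \<in> {x. G x \<noteq> 0} \<longrightarrow> g t - \<omega>\<^sup>2 * G t = profile t - \<omega>\<^sup>2 * G t"
    using AE_eq_profile by eventually_elim simp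
  show "continuous_on {x. G x \<noteq> 0} (\<lambda>x. profile x - \<omega>\<^sup>2 * G x)"
    unfolding profile_def by (intro continuous_intros continuous_on_energy continuous_on_G) auto
qed (use assms in simp)

lemma DERIV_profile_off_zeros:
  assumes "G x \<noteq> 0"
  shows "(profile has_real_derivative 0) (at x)"
proof -
  have "(energy has_real_derivative 2 * G' x * profile x) (at x)"
    unfolding energy_def
    by (auto intro!: derivative_eq_intros DERIV_G'_off_zeros[OF assms] DERIV_G simp: algebra_simps)
  then have "((\<lambda>x. (energy x - E) / (2 * G x)) has_real_derivative
      (2 * G' x * profile x * (2 * G x) - (energy x - E) * (2 * G' x)) / (2 * G x * (2 * G x))) (at x)"
    using assms by (auto intro!: derivative_eq_intros DERIV_G)
  then have "((\<lambda>x. (energy x - E) / (2 * G x)) has_real_derivative 0) (at x)"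
    by (rule DERIV_cong) (simp add: energy_minus_level[OF assms])
  then show ?thesis
    by (simp add: profile_def[abs_def])
qed

lemma profile_const:
  assumes "open S" "connected S" "\<And>x. x \<in> S \<Longrightarrow> G x \<noteq> 0" "x \<in> S" "y \<in> S"
  shows "profile x = profile y"
  using has_field_derivative_0_imp_constant_on[of S profile] DERIV_profile_off_zeros assms
  by (metis constant_on_def)

lemma G_zero_at_jump_point:
  assumes "jump_point g x"
  shows "G x = 0"
proof (rule ccontr)
  assume "G x \<noteq> 0"
  then have "x \<in> {y. G y \<noteq> 0}"
    by simp
  with open_nonzero_set obtain e where "e > 0" and "ball x e \<subseteq> {y. G y \<noteq> 0}"
    by (rule openE)
  then have nonzero: "G y \<noteq> 0" if "y \<in> ball x e" for y
    using that by blast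
  have profile_eq: "profile y = profile x" if "y \<in> ball x e" for y
    by (rule profile_const[OF open_ball connected_ball nonzero that]) (simp_all add: \<open>e > 0\<close>)
  have "AE y in lborel. y \<in> ball x e \<longrightarrow> g y = profile x"
    using AE_eq_profile by eventually_elim (simp add: nonzero profile_eq del: mem_ball)
  then show False
    using not_jump_pointI[of "ball x e" x g] \<open>e > 0\<close> assms by simp
qed

lemma G'_at_jump_point: "jump_point g x \<Longrightarrow> G' x = sqrt E \<or> G' x = - sqrt E"
  using abs_G'_at_zero[OF G_zero_at_jump_point, of x] by linarith

end

section \<open>Extremal slopes under rotational symmetry\<close>

locale symmetric_oscillator_level = oscillator_level +
  fixes \<tau> :: real
  assumes \<omega>_pos: "\<omega> > 0" and \<tau>_pos: "\<tau> > 0" and \<tau>_le: "\<tau> \<le> pi / \<omega>"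
    and G_symmetric: "G (x + \<tau>) = G x"
begin

lemma nodal_interval_signs:
  assumes "G z = 0" "G x \<noteq> 0"
  obtains a b where "G a = 0" "G b = 0" "0 \<le> G x * G' a" "G x * G' b \<le> 0" "G x * profile x \<le> 0"
proof -
  obtain a b where ab: "a < x" "x < b" "b - a \<le> \<tau>" "G a = 0" "G b = 0"
    and nonzero: "\<And>y. y \<in> {a<..<b} \<Longrightarrow> G y \<noteq> 0"
    using periodic_nodal_interval[OF continuous_on_G \<tau>_pos G_symmetric assms] by metis
  have "(G' has_real_derivative profile x - \<omega>\<^sup>2 * G y) (at y)" if "y \<in> {a<..<b}" for y
    using DERIV_G'_off_zeros[OF nonzero[OF that]]
      profile_const[OF open_greaterThanLessThan connected_Ioo nonzero that, of x] ab by simp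
  note signs = forced_oscillator_nodal_interval[OF \<omega>_pos _ DERIV_G continuous_on_G' this
      ab(4,5) nonzero, of x]
  show thesis
    by (rule that[OF ab(4,5)]) (use signs ab \<tau>_le in auto)
qed

lemma energy_le_level:
  assumes "G z = 0"
  shows "energy x \<le> E"
proof (cases "G x = 0")
  case True
  then show ?thesis
    by (simp add: energy_at_zero)
next
  case False
  then have "G x * profile x \<le> 0"
    using nodal_interval_signs[OF assms] by blast
  then show ?thesis
    using energy_minus_level[OF False] by simp
qed

lemma G'_bounds:
  assumes "G z = 0"
  shows "- sqrt E \<le> G' x" "G' x \<le> sqrt E"
proof -
  have "(G' x)\<^sup>2 \<le> energy x"
    by (simp add: energy_def)
  also have "energy x \<le> E"
    by (rule energy_le_level[OF assms])
  finally have "\<bar>G' x\<bar> \<le> sqrt E"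
    by (simp add: real_le_rsqrt)
  then show "- sqrt E \<le> G' x" "G' x \<le> sqrt E"
    by linarith+
qed

lemma level_pos:
  assumes "jump_point g \<theta>"
  shows "E > 0"
proof (rule ccontr)
  assume "\<not> E > 0"
  then have "energy x \<le> 0" for x
    using energy_le_level[OF G_zero_at_jump_point[OF assms], of x] by linarith
  then have "\<omega>\<^sup>2 * (G x)\<^sup>2 \<le> 0" for x
    using zero_le_power2[of "G' x"] by (smt (verit) energy_def)
  then have "G = (\<lambda>x. 0)"
    using \<omega>_pos by (auto simp: mult_le_0_iff)
  then have "AE x in lborel. g x = 0"
    using AE_zero_of_indefinite_integral_const[of g 0] G'_indefinite_integral g_bounded_borel by simp
  then show False
    using not_jump_pointI[of UNIV \<theta> g 0] assms by simp
qed

lemma finite_jump_set: "finite (jump_set g p)"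
proof (cases "jump_set g p = {}")
  case False
  then have "E > 0"
    using level_pos by (auto simp: jump_set_def)
  then have "G' x \<noteq> 0" if "G x = 0" for x
    using abs_G'_at_zero[OF that] by auto
  then have "finite ({0..p} \<inter> {x. G x = 0})"
    by (rule finite_simple_zeros[OF compact_Icc DERIV_G])
  then show ?thesis
    by (rule rev_finite_subset) (auto simp: jump_set_def G_zero_at_jump_point)
qed simp

lemma extremal_slopes_attained:
  assumes "G z = 0" "E > 0"
  shows "\<exists>x. G' x = sqrt E" "\<exists>x. G' x = - sqrt E"
proof -
  have "G' z \<noteq> 0"
    using abs_G'_at_zero[OF assms(1)] assms(2) by auto
  then obtain x where "G x \<noteq> 0"
    using assms(1) by (metis DERIV_G DERIV_const DERIV_unique ext)
  then obtain a b where "G a = 0" "G b = 0" "0 \<le> G x * G' a" "G x * G' b \<le> 0"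
    using nodal_interval_signs[OF assms(1)] by metis
  moreover from this have "\<bar>G' a\<bar> = sqrt E" "\<bar>G' b\<bar> = sqrt E"
    by (simp_all add: abs_G'_at_zero)
  ultimately have "G' a = sqrt E \<and> G' b = - sqrt E \<or> G' a = - sqrt E \<and> G' b = sqrt E"
    using \<open>G x \<noteq> 0\<close> assms(2) by (auto simp: zero_le_mult_iff mult_le_0_iff abs_if split: if_splits)
  then show "\<exists>x. G' x = sqrt E" "\<exists>x. G' x = - sqrt E"
    by auto
qed

end

theorem mainTheorem4:
  fixes m :: nat and g G :: "real \<Rightarrow> real"
  assumes m: "m \<ge> 4"
    and g_meas: "g \<in> borel_measurable lborel"
    and g_bdd: "bounded (range g)"
    and g_sym: "\<forall>x. g (x + 2 * pi / real m) = g x"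
    and G_sym: "\<forall>x. G (x + 2 * pi / real m) = G x"
    and G_diff: "\<forall>x. G differentiable (at x)"
    and G_eq: "\<forall>a b. a \<le> b \<longrightarrow>
                 deriv G b - deriv G a = integral {a..b} (\<lambda>x. g x - 4 * G x)"
    and steady: "\<forall>\<phi>. smooth_periodic \<phi> \<longrightarrow>
                 integral {0..2 * pi} (\<lambda>x. G x * g x * deriv \<phi> x + deriv G x * g x * \<phi> x) = 0"
  shows "(\<exists>c. AE x in lborel. g x = c) \<or>
         (\<exists>J M. finite J \<and> J \<noteq> {} \<and> J \<subseteq> {0..<2 * pi} \<and>
            (\<forall>a b. a < b \<and> {a<..<b} \<inter> {\<theta> + 2 * pi * of_int k | \<theta> k. \<theta> \<in> J} = {}
                    \<longrightarrow> ae_const_on g a b) \<and>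
            (\<forall>\<theta>\<in>J. \<forall>\<epsilon>>0. \<not> ae_const_on g (\<theta> - \<epsilon>) (\<theta> + \<epsilon>)) \<and>
            M > 0 \<and> (\<forall>x. - M \<le> deriv G x \<and> deriv G x \<le> M) \<and>
            (\<exists>x. deriv G x = M) \<and> (\<exists>x. deriv G x = - M) \<and>
            (\<forall>\<theta>\<in>J. deriv G \<theta> = M \<or> deriv G \<theta> = - M))"
proof -
  interpret steady_oscillator 2 g G
    by unfold_locales (use assms periodic_of_period_fraction[of m g "2 * pi"]
        periodic_of_period_fraction[of m G "2 * pi"] in \<open>simp_all add: bounded_borel_def\<close>)
  obtain E where "AE x in lborel. 2 * G x * g x = energy x - E"
    using ex_first_integral by blast
  then interpret symmetric_oscillator_level 2 g G E "2 * pi / real m"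
    using m G_sym by unfold_locales (simp_all add: field_simps)
  let ?J = "jump_set g (2 * pi)"
  show ?thesis
  proof (cases "?J = {}")
    case True
    then show ?thesis
      using AE_const_of_jump_set_empty[of "2 * pi" g] g_periodic by simp
  next
    case False
    then obtain z where z: "jump_point g z"
      by (auto simp: jump_set_def)
    note zero = G_zero_at_jump_point[OF z] and level = level_pos[OF z]
    have "?J \<subseteq> {0..<2 * pi}" "\<forall>\<theta>\<in>?J. \<forall>\<epsilon>>0. \<not> ae_const_on g (\<theta> - \<epsilon>) (\<theta> + \<epsilon>)"
      by (auto simp: jump_set_def jump_point_def)
    moreover have "\<forall>\<theta>\<in>?J. G' \<theta> = sqrt E \<or> G' \<theta> = - sqrt E"
      using G'_at_jump_point by (simp add: jump_set_def)
    moreover have "ae_const_on g a b"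
      if "{a<..<b} \<inter> {\<theta> + 2 * pi * of_int k | \<theta> k. \<theta> \<in> ?J} = {}" for a b
      by (rule ae_const_on_off_jump_set[OF _ g_periodic that]) simp
    ultimately show ?thesis
      using False level finite_jump_set extremal_slopes_attained[OF zero level] G'_bounds[OF zero]
      by (intro disjI2 exI[of _ ?J] exI[of _ "sqrt E"]) simp
  qed
qed

end
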